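(* Let $\alpha \in [0,1]$ be fixed. Assume that $\{X_{(x_1,x_2)}\}_{(x_1,x_2)\in\mathbb{R}^2}$ is a (real-valued) stochastic field, defined on a probability space $(\Omega,\mathcal{F},\mathbb{P})$, for which there exist constants $\beta,\eta,c,R>0$ such that $$\mathbb{E}\big[|\Delta X_{(h_1,h_2);(x_1,x_2)}|^\eta\big] \le c\,\Big(\max\{|h_1|,|h_2|\}^{1-\alpha}\min\{|h_1|,|h_2|\}^{1+\alpha}\Big)^{1+\beta}$$ for all $(x_1,x_2)\in\mathbb{R}^2$ and all $(h_1,h_2)\in\mathbb{R}^2$ with $|h_1|<R$ and $|h_2|<R$. Then there exists a version $\{\widetilde X_{(x_1,x_2)}\}_{(x_1,x_2)\in\mathbb{R}^2}$ of $\{X_{(x_1,x_2)}\}_{(x_1,x_2)\in\mathbb{R}^2}$ such that, for every $\gamma\in[0,\frac{\beta}{\eta})$, for all bounded intervals $I,J$ of $\mathbb{R}$ and for all $\omega\in\Omega$, there exists a finite constant $C(\omega)>0$ such that $$|\Delta \widetilde X_{(h_1,h_2);(x_1,x_2)}(\omega)| \le C(\omega)\Big(\max\{|h_1|,|h_2|\}^{1-\alpha}\min\{|h_1|,|h_2|\}^{1+\alpha}\Big)^{\gamma}$$ for all $x_1\in I$, $x_2\in J$ and $h_1,h_2\in\mathbb{R}$ with $x_1+h_1\in I$ and $x_2+h_2\in J$.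
   Context: For a field $X$ indexed by $\mathbb{R}^2$, the rectangular increment at $(x_1,x_2)$ with step $(h_1,h_2)$ is $$\Delta X_{(h_1,h_2);(x_1,x_2)} := X_{(x_1+h_1,x_2+h_2)}-X_{(x_1+h_1,x_2)}-X_{(x_1,x_2+h_2)}+X_{(x_1,x_2)}.$$ A version of $X$ is a field $\widetilde X$ on the same probability space with $\mathbb{P}(\widetilde X_{(x_1,x_2)}=X_{(x_1,x_2)})=1$ for every $(x_1,x_2)\in\mathbb{R}^2$. The constant $C(\omega)$ may depend on $\gamma$, $I$, $J$ and $\omega$, but not on $x_1,x_2,h_1,h_2$. *)

theory Defs
  imports "HOL-Probability.Probability"
begin

text \<open>
  Powers are taken with powr, where 0 powr 0 = 0. For the bounds
  (max |h1| |h2| powr (1 - a) * min |h1| |h2| powr (1 + a)) powr g with a, g \<ge> 0 the convention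
  is immaterial: the base vanishes only if h1 = 0 or h2 = 0, and then the rectangular increment
  is identically 0.
\<close>

definition random_field :: "'a measure \<Rightarrow> (real \<times> real \<Rightarrow> 'a \<Rightarrow> real) \<Rightarrow> bool" where
  "random_field M X \<longleftrightarrow> (\<forall>x. X x \<in> borel_measurable M)"

definition rect_increment ::
  "(real \<times> real \<Rightarrow> 'a \<Rightarrow> real) \<Rightarrow> real \<times> real \<Rightarrow> real \<times> real \<Rightarrow> 'a \<Rightarrow> real" where
  "rect_increment X h x \<omega> =
     X (fst x + fst h, snd x + snd h) \<omega> - X (fst x + fst h, snd x) \<omega>
     - X (fst x, snd x + snd h) \<omega> + X (fst x, snd x) \<omega>"

text \<open>
  A version is again a random field on the same space. When both fields are measurable, the
  event below is measurable, so its measure is the genuine probability.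
\<close>
definition is_version ::
  "'a measure \<Rightarrow> (real \<times> real \<Rightarrow> 'a \<Rightarrow> real) \<Rightarrow> (real \<times> real \<Rightarrow> 'a \<Rightarrow> real) \<Rightarrow> bool" where
  "is_version M Y X \<longleftrightarrow>
     random_field M Y \<and> (\<forall>x. measure M {\<omega> \<in> space M. Y x \<omega> = X x \<omega>} = 1)"

end

theory Submission
  imports Defs
begin

text \<open>
  Let \<open>\<phi> s t = max s t powr (1 - \<alpha>) * min s t powr (1 + \<alpha>)\<close>. Besides monotonicity, the proof only needs
  \<open>\<phi> s t \<le> s * t\<close>. For \<open>\<delta> = \<beta> - \<gamma> * \<eta> > 0\<close> the \<open>2 ^ (m + l)\<close> dyadic boxes of size
  \<open>2 ^ -m \<times> 2 ^ -l\<close> per unit area satisfy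
  \<open>E (\<bar>\<Delta>X\<bar> / \<phi> powr \<gamma>) powr \<eta> \<le> c * \<phi> powr (1 + \<delta>) \<le> c * 2 powr (- (m + l) * (1 + \<delta>))\<close>, so the
  expectation of the sum over all dyadic boxes of a bounded window is finite. Hence almost surely all
  dyadic boxes, of all side ratios, have increment at most \<open>K * \<phi> powr \<gamma>\<close>, and chaining in both
  coordinates extends this to all boxes with dyadic corners, for any smaller exponent.

  The increments of \<open>X\<close> say nothing about its values on the axes. So only the increment over
  \<open>[0, x] \<times> [0, y]\<close> is replaced, by its limit along the dyadic roundings of \<open>x\<close> and \<open>y\<close>;
  this changes it on a null set because the moments of the increments over the remaining thin strips
  are summable.
\<close>

subsection \<open>Gauge and box increments\<close>

definition gauge2 :: "real \<Rightarrow> real \<Rightarrow> real \<Rightarrow> real" where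
  "gauge2 \<alpha> a b = max a b powr (1 - \<alpha>) * min a b powr (1 + \<alpha>)"

lemma gauge2_nonneg: "0 \<le> gauge2 \<alpha> a b"
  by (simp add: gauge2_def)

lemma gauge2_commute: "gauge2 \<alpha> a b = gauge2 \<alpha> b a"
  by (simp add: gauge2_def max.commute min.commute)

lemma gauge2_pos: "0 < a \<Longrightarrow> 0 < b \<Longrightarrow> 0 < gauge2 \<alpha> a b"
  by (auto simp: gauge2_def max_def min_def)

lemma gauge2_mono:
  assumes "0 \<le> \<alpha>" "\<alpha> \<le> 1" "0 \<le> a" "a \<le> a'" "0 \<le> b" "b \<le> b'"
  shows "gauge2 \<alpha> a b \<le> gauge2 \<alpha> a' b'"
  unfolding gauge2_def using assms by (intro mult_mono powr_mono2) (auto simp: max_def min_def)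

text \<open>With \<open>b\<close> the smaller side, the gauge is
  \<open>a powr (1 - \<alpha>) * b powr \<alpha> * b\<close>, and \<alpha> \<ge> 0 allows raising
  \<open>b powr \<alpha>\<close> to \<open>a powr \<alpha>\<close>. Bounding by the area is what
  later decouples the two coordinates.\<close>

lemma gauge2_le_mult:
  assumes "0 \<le> \<alpha>" "\<alpha> \<le> 1" "0 \<le> a" "0 \<le> b"
  shows "gauge2 \<alpha> a b \<le> a * b"
proof -
  have *: "gauge2 \<alpha> a b \<le> a * b" if "b \<le> a" "0 \<le> b" for a b
  proof (cases "b = 0")
    case False
    with that have pos: "0 < b" "0 < a" by auto
    have "gauge2 \<alpha> a b = a powr (1 - \<alpha>) * (b powr \<alpha> * b)"
      using that pos by (simp add: gauge2_def max_def min_def powr_add)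
    also have "\<dots> \<le> a powr (1 - \<alpha>) * (a powr \<alpha> * b)"
      using that assms pos by (intro mult_left_mono mult_right_mono powr_mono2) auto
    also have "\<dots> = a powr (1 - \<alpha> + \<alpha>) * b"
      unfolding powr_add by (simp add: mult.assoc)
    also have "\<dots> = a * b"
      using pos by simp
    finally show ?thesis .
  qed (use that in \<open>auto simp: gauge2_def min_def\<close>)
  show ?thesis
  proof (cases "b \<le> a")
    case False
    then show ?thesis
      using *[of a b] assms by (metis gauge2_commute linear mult.commute)
  qed (use * assms in auto)
qed

text \<open>Positive limits keep both \<open>powr\<close> bases away from 0, where the factor with
  exponent \<open>1 - \<alpha>\<close> jumps if \<alpha> = 1. Degenerate boxes are treated
  separately.\<close>

lemma tendsto_gauge2:
  assumes "(f \<longlongrightarrow> a) F" "(g \<longlongrightarrow> b) F" "0 < a" "0 < b"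
  shows "((\<lambda>n. gauge2 \<alpha> (f n) (g n)) \<longlongrightarrow> gauge2 \<alpha> a b) F"
  unfolding gauge2_def using assms by (intro tendsto_intros) (auto simp: max_def min_def)

text \<open>Corners instead of base point and step make the increment additive under subdivision and
  change only its sign when end points are swapped.\<close>

definition box_inc :: "(real \<times> real \<Rightarrow> real) \<Rightarrow> real \<Rightarrow> real \<Rightarrow> real \<Rightarrow> real \<Rightarrow> real" where
  "box_inc f a b c e = f (b, e) - f (b, c) - f (a, e) + f (a, c)"

lemma rect_increment_eq_box_inc:
  "rect_increment X (h1, h2) (x1, x2) \<omega> = box_inc (\<lambda>p. X p \<omega>) x1 (x1 + h1) x2 (x2 + h2)"
  by (simp add: rect_increment_def box_inc_def)

lemma box_inc_degenerate [simp]: "box_inc f a a c e = 0" "box_inc f a b c c = 0"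
  by (simp_all add: box_inc_def)

subsection \<open>Dyadic chaining\<close>

text \<open>The factor \<open>r\<close> scales the grid so that every elementary side
  \<open>r / 2 ^ n\<close> is at most \<open>r\<close>, the range in which moments are
  controlled.\<close>

definition dyadic :: "real \<Rightarrow> nat \<Rightarrow> int \<Rightarrow> real" where
  "dyadic r n i = r * of_int i / 2 ^ n"

definition dyadic_floor :: "real \<Rightarrow> nat \<Rightarrow> real \<Rightarrow> int" where
  "dyadic_floor r n x = \<lfloor>x * 2 ^ n / r\<rfloor>"

abbreviation dyadic_round :: "real \<Rightarrow> nat \<Rightarrow> real \<Rightarrow> real" where
  "dyadic_round r n x \<equiv> dyadic r n (dyadic_floor r n x)"

lemma dyadic_Suc_double: "dyadic r (Suc n) (2 * i) = dyadic r n i"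
  by (simp add: dyadic_def)

lemma dyadic_zero [simp]: "dyadic r n 0 = 0"
  by (simp add: dyadic_def)

lemma dyadic_diff: "dyadic r n b - dyadic r n a = r * of_int (b - a) / 2 ^ n"
  by (simp add: dyadic_def field_simps)

lemma dyadic_floor_bounds:
  assumes "0 < r"
  shows "dyadic_round r n x \<le> x" "x < dyadic_round r n x + r / 2 ^ n"
proof -
  have "x * 2 ^ n / r < of_int \<lfloor>x * 2 ^ n / r\<rfloor> + 1"
    by linarith
  then have "x * 2 ^ n < r * (of_int \<lfloor>x * 2 ^ n / r\<rfloor> + 1)"
    using pos_divide_less_eq[OF assms] by (metis mult.commute)
  then show "x < dyadic_round r n x + r / 2 ^ n"
    by (simp add: dyadic_def dyadic_floor_def pos_less_divide_eq distrib_left flip: add_divide_distrib)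
  have "of_int \<lfloor>x * 2 ^ n / r\<rfloor> \<le> x * 2 ^ n / r"
    by (rule of_int_floor_le)
  then show "dyadic_round r n x \<le> x"
    unfolding pos_le_divide_eq[OF assms] dyadic_def dyadic_floor_def
    by (simp add: pos_divide_le_eq mult.commute)
qed

lemma dyadic_floor_Suc:
  "dyadic_floor r (Suc n) x = 2 * dyadic_floor r n x \<or>
   dyadic_floor r (Suc n) x = 2 * dyadic_floor r n x + 1"
proof -
  have "x * 2 ^ Suc n / r = 2 * (x * 2 ^ n / r)" by simp
  then show ?thesis unfolding dyadic_floor_def by linarith
qed

lemma dyadic_floor_window:
  assumes "0 < r" "\<bar>x\<bar> \<le> real N * r"
  shows "\<bar>dyadic_floor r n x\<bar> \<le> int N * 2 ^ n"
proof -
  define K where "K = int N * 2 ^ n"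
  have "\<bar>x * 2 ^ n / r\<bar> \<le> of_int K"
    using assms by (simp add: K_def abs_mult field_simps)
  then have "\<bar>\<lfloor>x * 2 ^ n / r\<rfloor>\<bar> \<le> K"
    by linarith
  then show ?thesis
    by (simp add: dyadic_floor_def K_def)
qed

lemma dyadic_floor_tendsto:
  assumes "0 < r"
  shows "(\<lambda>n. dyadic_round r n x) \<longlonglongrightarrow> x"
proof (rule tendsto_sandwich)
  have "(\<lambda>n. x - r * (1 / 2) ^ n) \<longlonglongrightarrow> x - r * 0"
    by (intro tendsto_intros LIMSEQ_realpow_zero) auto
  then show "(\<lambda>n. x - r * (1 / 2) ^ n) \<longlonglongrightarrow> x"
    by simp
  have "x - r * (1 / 2) ^ n \<le> dyadic_round r n x" for n
    using dyadic_floor_bounds(2)[OF assms, of x n] by (simp add: power_one_over)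
  then show "\<forall>\<^sub>F n in sequentially. x - r * (1 / 2) ^ n \<le> dyadic_round r n x"
    by (rule always_eventually[OF allI])
  show "\<forall>\<^sub>F n in sequentially. dyadic_round r n x \<le> x"
    by (intro always_eventually allI dyadic_floor_bounds(1)[OF assms])
qed auto

lemma int_steps_bound:
  fixes G :: "int \<Rightarrow> real"
  assumes "a \<le> b" "\<And>i. a \<le> i \<Longrightarrow> i < b \<Longrightarrow> \<bar>G (i + 1) - G i\<bar> \<le> B"
  shows "\<bar>G b - G a\<bar> \<le> of_int (b - a) * B"
  using assms
proof (induction b rule: int_ge_induct)
  case (step i)
  then have "\<bar>G i - G a\<bar> \<le> of_int (i - a) * B" "\<bar>G (i + 1) - G i\<bar> \<le> B" by auto
  then show ?case by (simp add: algebra_simps)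
qed simp

text \<open>
  The end points are rounded inward at each coarsening, so that every level that occurs is at most
  as coarse as the interval is long.
\<close>
lemma dyadic_chain:
  fixes G :: "nat \<Rightarrow> int \<Rightarrow> real" and N :: nat
  assumes G: "\<And>n i. G (Suc n) (2 * i) = G n i"
    and step: "\<And>m i. \<bar>i\<bar> \<le> int N * 2 ^ m \<Longrightarrow> \<bar>G m (i + 1) - G m i\<bar> \<le> B m"
    and "a < b" "\<bar>a\<bar> \<le> int N * 2 ^ n" "\<bar>b\<bar> \<le> int N * 2 ^ n"
  shows "\<exists>k\<le>n. 2 ^ (n - k) \<le> b - a \<and> \<bar>G n b - G n a\<bar> \<le> (2 * real N + 2) * (\<Sum>m=k..n. B m)"
  using assms(3-)
proof (induction n arbitrary: a b)
  case 0
  have B0: "0 \<le> B 0"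
    using step[of 0 0] by (simp add: order_trans[OF abs_ge_zero])
  \<comment> \<open>At level 0 the window has at most \<open>2 * N\<close> steps. The constant
    \<open>2 * N + 2\<close> dominates this as well as the two end pieces of each finer
    level.\<close>
  have "\<bar>G 0 b - G 0 a\<bar> \<le> of_int (b - a) * B 0"
    using 0 by (intro int_steps_bound step) auto
  also have "\<dots> \<le> (2 * real N + 2) * B 0"
    using 0 B0 by (intro mult_right_mono) auto
  finally show ?case using 0 by auto
next
  case (Suc n)
  define a' b' where "a' = - ((- a) div 2)" and "b' = b div 2"
  have B0: "0 \<le> B m" for m
    using step[of 0 m] by (simp add: order_trans[OF abs_ge_zero])
  have a: "a = 2 * a' \<or> a + 1 = 2 * a'" and b: "b = 2 * b' \<or> b = 2 * b' + 1"
    unfolding a'_def b'_def by presburger+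
  have win: "\<bar>a'\<bar> \<le> int N * 2 ^ n" "\<bar>b'\<bar> \<le> int N * 2 ^ n"
    using a b Suc.prems unfolding power_Suc by linarith+
  have "\<bar>G (Suc n) a - G n a'\<bar> \<le> B (Suc n)"
    using a step[OF Suc.prems(2)] B0[of "Suc n"] unfolding G[of n a', symmetric]
    by (auto simp: abs_minus_commute)
  moreover have "\<bar>G (Suc n) b - G n b'\<bar> \<le> B (Suc n)"
    using b step[of "2 * b'" "Suc n"] win B0[of "Suc n"] unfolding G[of n b', symmetric] by auto
  ultimately have ends: "\<bar>G (Suc n) b - G (Suc n) a\<bar> \<le> \<bar>G n b' - G n a'\<bar> + 2 * B (Suc n)"
    by linarith
  \<comment> \<open>Inward rounding cannot make the end points cross, because \<open>a < b\<close>
    are integers.\<close>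
  consider "a' < b'" | "a' = b'"
    using a b Suc.prems(1) by linarith
  then show ?case
  proof cases
    case 1
    obtain k where k: "k \<le> n" "2 ^ (n - k) \<le> b' - a'"
      "\<bar>G n b' - G n a'\<bar> \<le> (2 * real N + 2) * (\<Sum>m=k..n. B m)"
      using Suc.IH[OF 1 win] by blast
    have "2 ^ (Suc n - k) \<le> b - a"
      using k(1,2) a b by (auto simp: Suc_diff_le)
    moreover have "2 * B (Suc n) \<le> (2 * real N + 2) * B (Suc n)"
      using B0 by (intro mult_right_mono) auto
    then have "\<bar>G (Suc n) b - G (Suc n) a\<bar> \<le> (2 * real N + 2) * (\<Sum>m=k..Suc n. B m)"
      using ends k by (simp add: distrib_left)
    ultimately show ?thesis using k(1) by (intro exI[of _ k]) auto
  next
    \<comment> \<open>No coarser interval is left: the two end pieces at level \<open>Suc n\<close>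
      are everything, so \<open>k = Suc n\<close>.\<close>
    case 2
    have "2 * B (Suc n) \<le> (2 * real N + 2) * B (Suc n)"
      using B0 by (intro mult_right_mono) auto
    then show ?thesis using 2 ends Suc.prems(1) by (intro exI[of _ "Suc n"]) auto
  qed
qed

lemma dyadic_powr_eq:
  fixes r \<epsilon> :: real
  assumes "0 < r"
  shows "(r / 2 ^ m) powr \<epsilon> = r powr \<epsilon> * (2 powr (- \<epsilon>)) ^ m"
proof -
  have "(2 ^ m :: real) powr \<epsilon> = (2 powr \<epsilon>) ^ m" for m
    by (simp add: powr_realpow[symmetric] powr_powr mult.commute)
  then show ?thesis
    using assms by (simp add: powr_divide powr_minus power_inverse divide_inverse[of "r powr \<epsilon>"])
qed

lemma summable_dyadic_powr:
  fixes r \<epsilon> :: real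
  assumes "0 < r" "0 < \<epsilon>"
  shows "summable (\<lambda>m. (r / 2 ^ m) powr \<epsilon>)"
  unfolding dyadic_powr_eq[OF assms(1)] using assms
  by (intro summable_mult summable_geometric) (simp add: powr_less_one)

text \<open>Only levels whose mesh is at most the interval length occur in the chain, so
  monotonicity replaces each weight by its value at that length. The remaining powers form a
  geometric series, bounded independently of \<open>n\<close>. The lemma is applied once per
  coordinate.\<close>

lemma dyadic_chain_weighted:
  fixes G :: "nat \<Rightarrow> int \<Rightarrow> real" and N :: nat
  assumes "0 < r" "0 < \<epsilon>"
    and G: "\<And>n i. G (Suc n) (2 * i) = G n i"
    and w0: "\<And>t. 0 \<le> w t" and w: "\<And>s t. 0 \<le> s \<Longrightarrow> s \<le> t \<Longrightarrow> w s \<le> w t"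
    and step: "\<And>m i. \<bar>i\<bar> \<le> int N * 2 ^ m \<Longrightarrow>
      \<bar>G m (i + 1) - G m i\<bar> \<le> w (r / 2 ^ m) * (r / 2 ^ m) powr \<epsilon>"
    and "a < b" "\<bar>a\<bar> \<le> int N * 2 ^ n" "\<bar>b\<bar> \<le> int N * 2 ^ n"
  shows "\<bar>G n b - G n a\<bar> \<le>
    (2 * real N + 2) * (w (r * of_int (b - a) / 2 ^ n) * (\<Sum>m. (r / 2 ^ m) powr \<epsilon>))"
proof -
  define h where "h = r * of_int (b - a) / 2 ^ n"
  obtain k where k: "k \<le> n" "2 ^ (n - k) \<le> b - a" and
    bd: "\<bar>G n b - G n a\<bar> \<le> (2 * real N + 2) * (\<Sum>m=k..n. w (r / 2 ^ m) * (r / 2 ^ m) powr \<epsilon>)"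
    using dyadic_chain[where G = G and B = "\<lambda>m. w (r / 2 ^ m) * (r / 2 ^ m) powr \<epsilon>", OF G step assms(7-9)]
    by blast
  \<comment> \<open>The condition \<open>2 ^ (n - k) \<le> b - a\<close> says that the coarsest mesh
    in the chain is at most \<open>h\<close>.\<close>
  have "r / 2 ^ k = r * real_of_int (2 ^ (n - k)) / 2 ^ n"
    using k(1) by (simp add: power_diff[of "2 :: real"])
  also have "\<dots> \<le> h"
    unfolding h_def using assms(1) k(2) by (intro divide_right_mono mult_left_mono) (auto simp del: of_int_power)
  finally have kh: "r / 2 ^ k \<le> h" .
  have "(\<Sum>m=k..n. w (r / 2 ^ m) * (r / 2 ^ m) powr \<epsilon>) \<le> (\<Sum>m=k..n. w h * (r / 2 ^ m) powr \<epsilon>)"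
  proof (intro sum_mono mult_right_mono w)
    fix m assume "m \<in> {k..n}"
    then have "r / 2 ^ m \<le> r / 2 ^ k"
      using assms(1) by (intro divide_left_mono) (auto simp: power_increasing)
    with kh show "r / 2 ^ m \<le> h" by simp
  qed (use assms(1) in auto)
  also have "\<dots> = w h * (\<Sum>m=k..n. (r / 2 ^ m) powr \<epsilon>)"
    by (simp add: sum_distrib_left)
  also have "\<dots> \<le> w h * (\<Sum>m. (r / 2 ^ m) powr \<epsilon>)"
    by (intro mult_left_mono sum_le_suminf summable_dyadic_powr assms w0) auto
  finally show ?thesis
    using bd unfolding h_def by (intro order_trans[OF bd] mult_left_mono) auto
qed

section \<open>Chaining in both coordinates\<close>

text \<open>A common level \<open>n\<close> for all four corners loses nothing, since coarser grids
  lie in finer ones. The window is \<open>[- N * r, N * r]\<close> in each coordinate, and absolute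
  values admit corners in any order.\<close>

definition dyadic_box_bound :: "(real \<times> real \<Rightarrow> real) \<Rightarrow> real \<Rightarrow> real \<Rightarrow> nat \<Rightarrow> real \<Rightarrow> real \<Rightarrow> bool" where
  "dyadic_box_bound f r \<alpha> N C \<gamma> \<longleftrightarrow> (\<forall>n a b c e.
    \<bar>a\<bar> \<le> int N * 2 ^ n \<longrightarrow> \<bar>b\<bar> \<le> int N * 2 ^ n \<longrightarrow> \<bar>c\<bar> \<le> int N * 2 ^ n \<longrightarrow> \<bar>e\<bar> \<le> int N * 2 ^ n \<longrightarrow>
    \<bar>box_inc f (dyadic r n a) (dyadic r n b) (dyadic r n c) (dyadic r n e)\<bar>
      \<le> C * gauge2 \<alpha> \<bar>dyadic r n b - dyadic r n a\<bar> \<bar>dyadic r n e - dyadic r n c\<bar> powr \<gamma>)"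

text \<open>
  The summation over the levels costs the difference between the exponents: of \<open>\<gamma>' = \<gamma> + \<epsilon>\<close>, the part
  \<open>\<gamma>\<close> is bounded by monotonicity of the gauge and the part \<open>\<epsilon>\<close> by \<open>gauge2 \<alpha> s t \<le> s * t\<close>, whose powers
  are summable over all pairs of levels.
\<close>
lemma box_chain:
  fixes f :: "real \<times> real \<Rightarrow> real" and N :: nat
  assumes "0 < r" "0 \<le> \<alpha>" "\<alpha> \<le> 1" "0 \<le> \<gamma>" "\<gamma> < \<gamma>'" "0 \<le> K"
    and elem: "\<And>m l i j. \<bar>i\<bar> \<le> int N * 2 ^ m \<Longrightarrow> \<bar>j\<bar> \<le> int N * 2 ^ l \<Longrightarrow>
      \<bar>box_inc f (dyadic r m i) (dyadic r m (i + 1)) (dyadic r l j) (dyadic r l (j + 1))\<bar>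
        \<le> K * gauge2 \<alpha> (r / 2 ^ m) (r / 2 ^ l) powr \<gamma>'"
  shows "\<exists>C\<ge>0. dyadic_box_bound f r \<alpha> N C \<gamma>"
proof -
  define \<epsilon> where "\<epsilon> = \<gamma>' - \<gamma>"
  have e: "0 < \<epsilon>" using assms by (simp add: \<epsilon>_def)
  define S where "S = (\<Sum>m. (r / 2 ^ m) powr \<epsilon>)"
  have S0: "0 \<le> S"
    unfolding S_def by (intro suminf_nonneg summable_dyadic_powr assms e) auto
  define L where "L = 2 * real N + 2"
  have L0: "0 \<le> L" by (simp add: L_def)
  \<comment> \<open>Each of the two chainings contributes a factor \<open>L * S\<close>.\<close>
  define C where "C = L * (L * (K * S) * S)"
  have C0: "0 \<le> C" unfolding C_def using L0 S0 assms by simp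
  have elem': "\<bar>box_inc f (dyadic r m i) (dyadic r m (i + 1)) (dyadic r l j) (dyadic r l (j + 1))\<bar>
      \<le> K * gauge2 \<alpha> (r / 2 ^ m) (r / 2 ^ l) powr \<gamma> * (r / 2 ^ m) powr \<epsilon> * (r / 2 ^ l) powr \<epsilon>"
    if "\<bar>i\<bar> \<le> int N * 2 ^ m" "\<bar>j\<bar> \<le> int N * 2 ^ l" for i j m l
  proof -
    let ?g = "gauge2 \<alpha> (r / 2 ^ m) (r / 2 ^ l)"
    have "?g powr \<gamma>' = ?g powr \<gamma> * ?g powr \<epsilon>"
      by (simp add: \<epsilon>_def flip: powr_add)
    also have "\<dots> \<le> ?g powr \<gamma> * (r / 2 ^ m * (r / 2 ^ l)) powr \<epsilon>"
      using assms e by (intro mult_left_mono powr_mono2 gauge2_le_mult gauge2_nonneg) auto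
    also have "\<dots> = ?g powr \<gamma> * ((r / 2 ^ m) powr \<epsilon> * (r / 2 ^ l) powr \<epsilon>)"
      using assms by (subst powr_mult) auto
    finally have "K * ?g powr \<gamma>' \<le> K * (?g powr \<gamma> * ((r / 2 ^ m) powr \<epsilon> * (r / 2 ^ l) powr \<epsilon>))"
      using assms by (intro mult_left_mono) auto
    with elem[OF that] show ?thesis by (simp add: mult.assoc)
  qed
  have main: "\<bar>box_inc f (dyadic r n a) (dyadic r n b) (dyadic r n c) (dyadic r n e)\<bar>
      \<le> C * gauge2 \<alpha> (dyadic r n b - dyadic r n a) (dyadic r n e - dyadic r n c) powr \<gamma>"
    if ab: "a < b" "\<bar>a\<bar> \<le> int N * 2 ^ n" "\<bar>b\<bar> \<le> int N * 2 ^ n"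
      and ce: "c < e" "\<bar>c\<bar> \<le> int N * 2 ^ n" "\<bar>e\<bar> \<le> int N * 2 ^ n" for n a b c e
  proof -
    define h where "h = r * of_int (e - c) / 2 ^ n"
    have h0: "0 \<le> h" using assms ce by (simp add: h_def)
    \<comment> \<open>First chaining, in the second coordinate, over a strip of elementary width
      \<open>r / 2 ^ m\<close>. The factor \<open>(r / 2 ^ m) powr \<epsilon>\<close> is carried
      along in the weight, so that the result is a one-step bound for chaining in the first
      coordinate.\<close>
    have strip: "\<bar>box_inc f (dyadic r m i) (dyadic r m (i + 1)) (dyadic r n c) (dyadic r n e)\<bar>
        \<le> (L * (K * S) * gauge2 \<alpha> (r / 2 ^ m) h powr \<gamma>) * (r / 2 ^ m) powr \<epsilon>"
      if "\<bar>i\<bar> \<le> int N * 2 ^ m" for i m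
    proof -
      define G where "G l j = f (dyadic r m (i + 1), dyadic r l j) - f (dyadic r m i, dyadic r l j)" for l j
      have "\<bar>G n e - G n c\<bar> \<le> (2 * real N + 2) *
        (K * gauge2 \<alpha> (r / 2 ^ m) (r * of_int (e - c) / 2 ^ n) powr \<gamma> * (r / 2 ^ m) powr \<epsilon> *
          (\<Sum>m. (r / 2 ^ m) powr \<epsilon>))"
        using ce
      proof (intro dyadic_chain_weighted[where w = "\<lambda>t. K * gauge2 \<alpha> (r / 2 ^ m) t powr \<gamma> * (r / 2 ^ m) powr \<epsilon>"] e assms)
        show "\<bar>G l (j + 1) - G l j\<bar> \<le> K * gauge2 \<alpha> (r / 2 ^ m) (r / 2 ^ l) powr \<gamma> * (r / 2 ^ m) powr \<epsilon> * (r / 2 ^ l) powr \<epsilon>"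
          if "\<bar>j\<bar> \<le> int N * 2 ^ l" for l j
          using elem'[OF \<open>\<bar>i\<bar> \<le> _\<close> that] by (simp add: G_def box_inc_def algebra_simps)
        show "K * gauge2 \<alpha> (r / 2 ^ m) s powr \<gamma> * (r / 2 ^ m) powr \<epsilon>
          \<le> K * gauge2 \<alpha> (r / 2 ^ m) t powr \<gamma> * (r / 2 ^ m) powr \<epsilon>" if "0 \<le> s" "s \<le> t" for s t
          using assms that by (intro mult_right_mono mult_left_mono powr_mono2 gauge2_mono gauge2_nonneg) auto
      qed (use assms in \<open>auto simp: G_def dyadic_Suc_double\<close>)
      also have "\<dots> = (L * (K * S) * gauge2 \<alpha> (r / 2 ^ m) h powr \<gamma>) * (r / 2 ^ m) powr \<epsilon>"
        unfolding L_def S_def h_def by (simp add: mult_ac)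
      finally show ?thesis by (simp add: G_def box_inc_def algebra_simps)
    qed
    \<comment> \<open>Second chaining, in the first coordinate, with the side from \<open>c\<close>
      to \<open>e\<close> fixed; \<open>strip\<close> supplies its one-step bound.\<close>
    define G where "G l j = f (dyadic r l j, dyadic r n e) - f (dyadic r l j, dyadic r n c)" for l j
    have "\<bar>G n b - G n a\<bar> \<le> (2 * real N + 2) *
        (L * (K * S) * gauge2 \<alpha> (r * of_int (b - a) / 2 ^ n) h powr \<gamma> * (\<Sum>m. (r / 2 ^ m) powr \<epsilon>))"
      using ab
    proof (intro dyadic_chain_weighted[where w = "\<lambda>t. L * (K * S) * gauge2 \<alpha> t h powr \<gamma>"] e assms)
      show "\<bar>G m (i + 1) - G m i\<bar> \<le> L * (K * S) * gauge2 \<alpha> (r / 2 ^ m) h powr \<gamma> * (r / 2 ^ m) powr \<epsilon>"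
        if "\<bar>i\<bar> \<le> int N * 2 ^ m" for i m
        using strip[OF that] by (simp add: G_def box_inc_def algebra_simps)
      show "L * (K * S) * gauge2 \<alpha> s h powr \<gamma> \<le> L * (K * S) * gauge2 \<alpha> t h powr \<gamma>"
        if "0 \<le> s" "s \<le> t" for s t
        using assms that h0 L0 S0 by (intro mult_left_mono powr_mono2 gauge2_mono gauge2_nonneg) auto
    qed (use assms L0 S0 in \<open>auto simp: G_def dyadic_Suc_double\<close>)
    also have "\<dots> = C * gauge2 \<alpha> (r * of_int (b - a) / 2 ^ n) h powr \<gamma>"
      unfolding C_def L_def[symmetric] S_def[symmetric] by (simp add: mult_ac)
    finally show ?thesis
      unfolding dyadic_diff h_def G_def box_inc_def by (simp add: algebra_simps)
  qed
  have mono_d: "dyadic r n a < dyadic r n b" if "a < b" for n a b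
    using assms(1) that by (simp add: dyadic_def divide_strict_right_mono)
  show ?thesis
    unfolding dyadic_box_bound_def
  proof (intro exI[of _ C] conjI allI impI C0)
    fix n a b c e
    assume w: "\<bar>a\<bar> \<le> int N * 2 ^ n" "\<bar>b\<bar> \<le> int N * 2 ^ n" "\<bar>c\<bar> \<le> int N * 2 ^ n" "\<bar>e\<bar> \<le> int N * 2 ^ n"
    show "\<bar>box_inc f (dyadic r n a) (dyadic r n b) (dyadic r n c) (dyadic r n e)\<bar>
      \<le> C * gauge2 \<alpha> \<bar>dyadic r n b - dyadic r n a\<bar> \<bar>dyadic r n e - dyadic r n c\<bar> powr \<gamma>"
    proof (cases "a = b \<or> c = e")
      case True
      then show ?thesis using C0 by auto
    next
      case False
      \<comment> \<open>Sorting the corners changes at most the sign of the increment.\<close>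
      define a' b' c' e' where "a' = min a b" and "b' = max a b" and "c' = min c e" and "e' = max c e"
      have "\<bar>box_inc f (dyadic r n a') (dyadic r n b') (dyadic r n c') (dyadic r n e')\<bar>
        \<le> C * gauge2 \<alpha> (dyadic r n b' - dyadic r n a') (dyadic r n e' - dyadic r n c') powr \<gamma>"
        using False w unfolding a'_def b'_def c'_def e'_def by (intro main) (auto simp: min_def max_def)
      moreover have "dyadic r n b' - dyadic r n a' = \<bar>dyadic r n b - dyadic r n a\<bar>"
        "dyadic r n e' - dyadic r n c' = \<bar>dyadic r n e - dyadic r n c\<bar>"
        using False mono_d[of a b n] mono_d[of b a n] mono_d[of c e n] mono_d[of e c n]
        unfolding a'_def b'_def c'_def e'_def by (auto simp: min_def max_def)
      moreover have "\<bar>box_inc f (dyadic r n a') (dyadic r n b') (dyadic r n c') (dyadic r n e')\<bar> =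
        \<bar>box_inc f (dyadic r n a) (dyadic r n b) (dyadic r n c) (dyadic r n e)\<bar>"
        unfolding a'_def b'_def c'_def e'_def by (auto simp: min_def max_def box_inc_def)
      ultimately show ?thesis by simp
    qed
  qed
qed

lemma dyadic_box_boundD:
  assumes "dyadic_box_bound f r \<alpha> N C \<gamma>" "\<bar>a\<bar> \<le> int N * 2 ^ n" "\<bar>b\<bar> \<le> int N * 2 ^ n"
    "\<bar>c\<bar> \<le> int N * 2 ^ n" "\<bar>e\<bar> \<le> int N * 2 ^ n"
  shows "\<bar>box_inc f (dyadic r n a) (dyadic r n b) (dyadic r n c) (dyadic r n e)\<bar>
      \<le> C * gauge2 \<alpha> \<bar>dyadic r n b - dyadic r n a\<bar> \<bar>dyadic r n e - dyadic r n c\<bar> powr \<gamma>"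
  using assms unfolding dyadic_box_bound_def by blast

section \<open>Limits along dyadic roundings\<close>

lemma dyadic_round_Suc_diff:
  assumes "0 < r"
  shows "\<bar>dyadic_round r (Suc n) x - dyadic_round r n x\<bar> \<le> r / 2 ^ Suc n"
proof -
  have "dyadic_round r (Suc n) x - dyadic_round r n x =
      r * of_int (dyadic_floor r (Suc n) x - 2 * dyadic_floor r n x) / 2 ^ Suc n"
    unfolding dyadic_Suc_double[of r n, symmetric] by (rule dyadic_diff)
  moreover have "dyadic_floor r (Suc n) x - 2 * dyadic_floor r n x = 0 \<or>
      dyadic_floor r (Suc n) x - 2 * dyadic_floor r n x = 1"
    using dyadic_floor_Suc[of r n x] by linarith
  ultimately show ?thesis using assms by (elim disjE) simp_all
qed

lemma dyadic_round_window:
  assumes "0 < r" "\<bar>x\<bar> \<le> real N * r"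
  shows "\<bar>dyadic_round r n x\<bar> \<le> real N * r"
proof -
  have "\<bar>real_of_int (dyadic_floor r n x)\<bar> \<le> real N * 2 ^ n"
    using of_int_le_iff[THEN iffD2, OF dyadic_floor_window[OF assms, of n]] by simp
  then have "r * \<bar>real_of_int (dyadic_floor r n x)\<bar> \<le> r * (real N * 2 ^ n)"
    using assms(1) by (intro mult_left_mono) auto
  then show ?thesis
    using assms(1) by (simp add: dyadic_def abs_mult pos_divide_le_eq mult_ac)
qed

text \<open>Refining the roundings by one level adds two strips of width at most
  \<open>r / 2 ^ Suc n\<close> and length at most \<open>N * r\<close>. As \<gamma> > 0, their
  increments are dominated by a geometric series, and the sequence telescopes.\<close>

lemma dyadic_box_convergent:
  assumes "0 < r" "0 \<le> \<alpha>" "\<alpha> \<le> 1" "0 < \<gamma>" "0 \<le> C"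
    and bound: "dyadic_box_bound f r \<alpha> N C \<gamma>"
    and x: "\<bar>x\<bar> \<le> real N * r" and y: "\<bar>y\<bar> \<le> real N * r"
  shows "convergent (\<lambda>n. box_inc f 0 (dyadic_round r n x) 0 (dyadic_round r n y))"
proof -
  let ?D = "dyadic_round r"
  define F where "F n = box_inc f 0 (?D n x) 0 (?D n y)" for n
  define E where "E n = C * ((r / 2 ^ Suc n) powr \<gamma> * (real N * r) powr \<gamma>)" for n
  have small: "C * gauge2 \<alpha> s t powr \<gamma> \<le> E n"
    if "0 \<le> s" "0 \<le> t" "s \<le> r / 2 ^ Suc n \<and> t \<le> real N * r \<or> t \<le> r / 2 ^ Suc n \<and> s \<le> real N * r" for s t n
  proof -
    have "gauge2 \<alpha> s t \<le> s * t"
      using assms that by (intro gauge2_le_mult)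
    also have "\<dots> \<le> r / 2 ^ Suc n * (real N * r)"
      using that(3) mult_mono[of s "r / 2 ^ Suc n" t "real N * r"] mult_mono[of t "r / 2 ^ Suc n" s "real N * r"]
        that(1,2) assms(1) by (auto simp: mult.commute)
    finally have "gauge2 \<alpha> s t powr \<gamma> \<le> (r / 2 ^ Suc n * (real N * r)) powr \<gamma>"
      using assms by (intro powr_mono2 gauge2_nonneg) auto
    also have "\<dots> = (r / 2 ^ Suc n) powr \<gamma> * (real N * r) powr \<gamma>"
      by (rule powr_mult)
    finally show ?thesis
      unfolding E_def using assms by (intro mult_left_mono) auto
  qed
  have Fdiff: "norm (F (Suc n) - F n) \<le> 2 * E n" for n
  proof -
    \<comment> \<open>Level \<open>n\<close> roundings enter as even indices at level
      \<open>Suc n\<close>, because \<open>dyadic_box_bound\<close> wants all corners on one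
      grid.\<close>
    have win: "\<bar>2 * dyadic_floor r n z\<bar> \<le> int N * 2 ^ Suc n" "\<bar>dyadic_floor r (Suc n) z\<bar> \<le> int N * 2 ^ Suc n"
      if "\<bar>z\<bar> \<le> real N * r" for z
      using dyadic_floor_window[OF assms(1) that, of n] dyadic_floor_window[OF assms(1) that, of "Suc n"] by auto
    have w0: "\<bar>0\<bar> \<le> int N * 2 ^ Suc n" by simp
    have "\<bar>box_inc f (?D n x) (?D (Suc n) x) 0 (?D n y)\<bar>
        \<le> C * gauge2 \<alpha> \<bar>?D (Suc n) x - ?D n x\<bar> \<bar>?D n y - 0\<bar> powr \<gamma>"
      using dyadic_box_boundD[OF bound win(1)[OF x] win(2)[OF x] w0 win(1)[OF y]]
      unfolding dyadic_Suc_double dyadic_zero .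
    also have "\<dots> \<le> E n"
      using dyadic_round_Suc_diff[OF assms(1), of n x] dyadic_round_window[OF assms(1) y, of n]
      by (intro small) (simp_all only: abs_ge_zero diff_zero simp_thms)
    finally have first: "\<bar>box_inc f (?D n x) (?D (Suc n) x) 0 (?D n y)\<bar> \<le> E n" .
    have "\<bar>box_inc f 0 (?D (Suc n) x) (?D n y) (?D (Suc n) y)\<bar>
        \<le> C * gauge2 \<alpha> \<bar>?D (Suc n) x - 0\<bar> \<bar>?D (Suc n) y - ?D n y\<bar> powr \<gamma>"
      using dyadic_box_boundD[OF bound w0 win(2)[OF x] win(1)[OF y] win(2)[OF y]]
      unfolding dyadic_Suc_double dyadic_zero .
    also have "\<dots> \<le> E n"
      using dyadic_round_Suc_diff[OF assms(1), of n y] dyadic_round_window[OF assms(1) x, of "Suc n"]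
      by (intro small) (simp_all only: abs_ge_zero diff_zero simp_thms)
    finally have second: "\<bar>box_inc f 0 (?D (Suc n) x) (?D n y) (?D (Suc n) y)\<bar> \<le> E n" .
    \<comment> \<open>The first side is refined while the second is still coarse, then the second
      while the first is already fine.\<close>
    have "F (Suc n) - F n =
      box_inc f (?D n x) (?D (Suc n) x) 0 (?D n y) + box_inc f 0 (?D (Suc n) x) (?D n y) (?D (Suc n) y)"
      by (simp add: F_def box_inc_def)
    with first second show ?thesis by simp
  qed
  have "summable (\<lambda>n. (r / 2 ^ Suc n) powr \<gamma>)"
    using summable_dyadic_powr[OF assms(1,4)] by (rule summable_Suc_iff[THEN iffD2])
  then have "summable E"
    unfolding E_def by (rule summable_mult[OF summable_mult2])
  then have "summable (\<lambda>n. 2 * E n)"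
    by (rule summable_mult)
  then have "summable (\<lambda>n. F (Suc n) - F n)"
    by (rule summable_comparison_test') (rule Fdiff)
  then have "convergent (\<lambda>n. F n - F 0)"
    unfolding summable_iff_convergent sum_lessThan_telescope .
  then show ?thesis
    unfolding F_def by (simp add: convergent_diff_const_right_iff)
qed

text \<open>Four increments anchored at the origin combine to the increment over the rounded box.
  That one obeys the dyadic bound at every level, and both sides of the bound converge when the box
  is not degenerate.\<close>

lemma box_inc_limit_bound:
  assumes "0 < r" "0 \<le> C"
    and bound: "dyadic_box_bound f r \<alpha> N C \<gamma>"
    and Z: "\<And>x y. \<bar>x\<bar> \<le> real N * r \<Longrightarrow> \<bar>y\<bar> \<le> real N * r \<Longrightarrow>
      (\<lambda>n. box_inc f 0 (dyadic_round r n x) 0 (dyadic_round r n y)) \<longlonglongrightarrow> Z (x, y)"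
    and win: "\<bar>a\<bar> \<le> real N * r" "\<bar>b\<bar> \<le> real N * r" "\<bar>c\<bar> \<le> real N * r" "\<bar>e\<bar> \<le> real N * r"
  shows "\<bar>box_inc Z a b c e\<bar> \<le> C * gauge2 \<alpha> \<bar>b - a\<bar> \<bar>e - c\<bar> powr \<gamma>"
proof (cases "a = b \<or> c = e")
  case True
  then show ?thesis using assms(2) by auto
next
  case False
  let ?D = "dyadic_round r"
  let ?h = "\<lambda>n. gauge2 \<alpha> \<bar>?D n b - ?D n a\<bar> \<bar>?D n e - ?D n c\<bar>"
  have "(\<lambda>n. box_inc f 0 (?D n b) 0 (?D n e) - box_inc f 0 (?D n b) 0 (?D n c)
      - box_inc f 0 (?D n a) 0 (?D n e) + box_inc f 0 (?D n a) 0 (?D n c)) \<longlonglongrightarrow> box_inc Z a b c e"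
    unfolding box_inc_def[of Z] by (intro tendsto_intros Z win)
  moreover have "box_inc f 0 (?D n b) 0 (?D n e) - box_inc f 0 (?D n b) 0 (?D n c)
      - box_inc f 0 (?D n a) 0 (?D n e) + box_inc f 0 (?D n a) 0 (?D n c)
      = box_inc f (?D n a) (?D n b) (?D n c) (?D n e)" for n
    by (simp add: box_inc_def)
  ultimately have lim: "(\<lambda>n. box_inc f (?D n a) (?D n b) (?D n c) (?D n e)) \<longlonglongrightarrow> box_inc Z a b c e"
    by simp
  have g: "gauge2 \<alpha> \<bar>b - a\<bar> \<bar>e - c\<bar> \<noteq> 0"
    using gauge2_pos[of "\<bar>b - a\<bar>" "\<bar>e - c\<bar>" \<alpha>] False by auto
  have "?h \<longlonglongrightarrow> gauge2 \<alpha> \<bar>b - a\<bar> \<bar>e - c\<bar>"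
    using False by (intro tendsto_gauge2 tendsto_rabs tendsto_diff dyadic_floor_tendsto assms(1)) auto
  then have "(\<lambda>n. C * ?h n powr \<gamma>) \<longlonglongrightarrow> C * gauge2 \<alpha> \<bar>b - a\<bar> \<bar>e - c\<bar> powr \<gamma>"
    using g by (intro tendsto_mult tendsto_powr tendsto_const)
  moreover have "\<bar>box_inc f (?D n a) (?D n b) (?D n c) (?D n e)\<bar> \<le> C * ?h n powr \<gamma>" for n
    by (intro dyadic_box_boundD[OF bound] dyadic_floor_window assms win)
  ultimately show ?thesis
    using LIMSEQ_le[OF tendsto_rabs[OF lim]] by blast
qed

subsection \<open>Fields with increment moments\<close>

text \<open>The range of the moment bound is closed, so that grid boxes with sides exactly
  \<open>r\<close> are included.\<close>

locale increment_moments = prob_space M for M :: "'a measure" +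
  fixes X :: "real \<times> real \<Rightarrow> 'a \<Rightarrow> real" and \<alpha> \<beta> \<eta> \<kappa> r :: real
  assumes \<alpha>: "0 \<le> \<alpha>" "\<alpha> \<le> 1" and \<beta>: "0 < \<beta>" and \<eta>: "0 < \<eta>" and \<kappa>: "0 < \<kappa>" and r: "0 < r"
    and X_measurable [measurable]: "\<And>p. X p \<in> borel_measurable M"
    and moment: "\<And>a b c e. \<bar>b - a\<bar> \<le> r \<Longrightarrow> \<bar>e - c\<bar> \<le> r \<Longrightarrow>
      (\<integral>\<^sup>+ \<omega>. ennreal (\<bar>box_inc (\<lambda>p. X p \<omega>) a b c e\<bar> powr \<eta>) \<partial>M)
        \<le> ennreal (\<kappa> * gauge2 \<alpha> \<bar>b - a\<bar> \<bar>e - c\<bar> powr (1 + \<beta>))"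
begin

section \<open>Almost sure bounds on elementary dyadic boxes\<close>

lemma box_inc_measurable [measurable]: "(\<lambda>\<omega>. box_inc (\<lambda>p. X p \<omega>) a b c e) \<in> borel_measurable M"
  unfolding box_inc_def by measurable

text \<open>The sum \<open>S\<close> of the normalised \<eta>-th powers over all boxes and all pairs
  of levels has finite expectation, hence is almost surely finite. It dominates each of its terms,
  so \<open>K\<close> can be taken as its power with exponent \<open>1 / \<eta>\<close>.\<close>

lemma AE_elementary_bound:
  assumes "0 \<le> \<gamma>" "\<gamma> < \<beta> / \<eta>"
  shows "AE \<omega> in M. \<exists>K\<ge>0. \<forall>m l i j. \<bar>i\<bar> \<le> int N * 2 ^ m \<longrightarrow> \<bar>j\<bar> \<le> int N * 2 ^ l \<longrightarrow>
    \<bar>box_inc (\<lambda>p. X p \<omega>) (dyadic r m i) (dyadic r m (i + 1)) (dyadic r l j) (dyadic r l (j + 1))\<bar>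
      \<le> K * gauge2 \<alpha> (r / 2 ^ m) (r / 2 ^ l) powr \<gamma>"
proof -
  define W where "W m = {- (int N * 2 ^ m) .. int N * 2 ^ m}" for m :: nat
  define g where "g m l = gauge2 \<alpha> (r / 2 ^ m) (r / 2 ^ l)" for m l :: nat
  define box where "box m l i j \<omega> =
    \<bar>box_inc (\<lambda>p. X p \<omega>) (dyadic r m i) (dyadic r m (i + 1)) (dyadic r l j) (dyadic r l (j + 1))\<bar>" for m l i j \<omega>
  define T where "T m l i j \<omega> = ennreal ((box m l i j \<omega> / g m l powr \<gamma>) powr \<eta>)" for m l i j \<omega>
  define S where "S \<omega> = (\<Sum>m. \<Sum>l. \<Sum>i\<in>W m. \<Sum>j\<in>W l. T m l i j \<omega>)" for \<omega>
  \<comment> \<open>The exponent left after normalisation is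
    \<open>1 + \<beta> - \<gamma> * \<eta> = 1 + \<delta>\<close>; the 1 is used up by counting
    boxes, \<delta> > 0 gives summability.\<close>
  define \<delta> where "\<delta> = \<beta> - \<gamma> * \<eta>"
  have \<delta>: "0 < \<delta>" using assms \<eta> by (simp add: \<delta>_def pos_less_divide_eq)
  \<comment> \<open>At most \<open>(2 * N + 1) * 2 ^ m\<close> indices occur at level
    \<open>m\<close>; multiplied by \<open>(r / 2 ^ m) powr (1 + \<delta>)\<close> this gives
    \<open>u m\<close>.\<close>
  define u where "u m = (2 * real N + 1) * r * (r / 2 ^ m) powr \<delta>" for m :: nat
  have u: "summable u" "\<And>m. 0 \<le> u m"
    unfolding u_def using r \<delta> by (auto intro!: summable_mult summable_dyadic_powr)
  have g0: "0 < g m l" for m l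
    unfolding g_def using r by (intro gauge2_pos) auto
  have [measurable]: "T m l i j \<in> borel_measurable M" for m l i j
    unfolding T_def box_def by measurable
  have single: "(\<integral>\<^sup>+ \<omega>. T m l i j \<omega> \<partial>M) \<le> ennreal (\<kappa> * (r / 2 ^ m * (r / 2 ^ l)) powr (1 + \<delta>))" for m l i j
  proof -
    have len: "\<bar>dyadic r m (i + 1) - dyadic r m i\<bar> = r / 2 ^ m" for m i
      unfolding dyadic_diff using r by simp
    have le_r: "r / 2 ^ m \<le> r" for m
      using r by (simp add: divide_le_eq)
    have "(\<integral>\<^sup>+ \<omega>. T m l i j \<omega> \<partial>M) =
        (\<integral>\<^sup>+ \<omega>. ennreal (1 / (g m l powr (\<gamma> * \<eta>))) * ennreal (box m l i j \<omega> powr \<eta>) \<partial>M)"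
      unfolding T_def box_def by (simp add: powr_divide powr_powr flip: ennreal_mult')
    also have "\<dots> = ennreal (1 / (g m l powr (\<gamma> * \<eta>))) * (\<integral>\<^sup>+ \<omega>. ennreal (box m l i j \<omega> powr \<eta>) \<partial>M)"
      by (intro nn_integral_cmult) (simp add: box_def)
    also have "\<dots> \<le> ennreal (1 / (g m l powr (\<gamma> * \<eta>))) * ennreal (\<kappa> * g m l powr (1 + \<beta>))"
      unfolding box_def g_def
      by (intro mult_left_mono order_trans[OF moment]) (simp_all add: len le_r)
    also have "\<dots> = ennreal (1 / (g m l powr (\<gamma> * \<eta>)) * (\<kappa> * g m l powr (1 + \<beta>)))"
      by (simp flip: ennreal_mult')
    also have "1 / (g m l powr (\<gamma> * \<eta>)) * (\<kappa> * g m l powr (1 + \<beta>)) = \<kappa> * g m l powr (1 + \<delta>)"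
      unfolding \<delta>_def by (simp add: powr_diff powr_add field_simps)
    \<comment> \<open>Passing from the gauge to the area makes the double series over
      \<open>m\<close> and \<open>l\<close> factor.\<close>
    also have "ennreal \<dots> \<le> ennreal (\<kappa> * (r / 2 ^ m * (r / 2 ^ l)) powr (1 + \<delta>))"
      unfolding g_def using \<kappa> \<delta> r \<alpha>
      by (intro ennreal_leI mult_left_mono powr_mono2 gauge2_le_mult gauge2_nonneg) auto
    finally show ?thesis .
  qed
  have card_W: "real (card (W m)) * (r / 2 ^ m) powr (1 + \<delta>) \<le> u m" for m
  proof -
    have "real (card (W m)) = 2 * real N * 2 ^ m + 1"
      by (simp add: W_def flip: of_nat_mult)
    also have "\<dots> \<le> (2 * real N + 1) * 2 ^ m"
      by (simp add: distrib_right)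
    finally have "real (card (W m)) * (r / 2 ^ m) powr (1 + \<delta>)
        \<le> ((2 * real N + 1) * 2 ^ m) * (r / 2 ^ m) powr (1 + \<delta>)"
      by (rule mult_right_mono) simp
    also have "\<dots> = u m"
      using r by (simp add: u_def powr_add)
    finally show ?thesis .
  qed
  have level: "(\<integral>\<^sup>+ \<omega>. (\<Sum>i\<in>W m. \<Sum>j\<in>W l. T m l i j \<omega>) \<partial>M) \<le> ennreal (\<kappa> * u m * u l)" for m l
  proof -
    let ?d = "\<lambda>m::nat. (r / 2 ^ m) powr (1 + \<delta>)"
    have "(\<integral>\<^sup>+ \<omega>. (\<Sum>i\<in>W m. \<Sum>j\<in>W l. T m l i j \<omega>) \<partial>M) = (\<Sum>i\<in>W m. \<Sum>j\<in>W l. \<integral>\<^sup>+ \<omega>. T m l i j \<omega> \<partial>M)"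
      by (simp add: nn_integral_sum)
    also have "\<dots> \<le> (\<Sum>i\<in>W m. \<Sum>j\<in>W l. ennreal (\<kappa> * (r / 2 ^ m * (r / 2 ^ l)) powr (1 + \<delta>)))"
      by (intro sum_mono single)
    also have "\<dots> = ennreal (real (card (W m)) * (real (card (W l)) * (\<kappa> * (?d m * ?d l))))"
      unfolding powr_mult using \<kappa> by (simp add: ennreal_mult' ennreal_of_nat_eq_real_of_nat)
    also have "real (card (W m)) * (real (card (W l)) * (\<kappa> * (?d m * ?d l)))
        = \<kappa> * ((real (card (W m)) * ?d m) * (real (card (W l)) * ?d l))"
      by (simp add: mult_ac)
    also have "ennreal \<dots> \<le> ennreal (\<kappa> * (u m * u l))"
      using \<kappa> by (intro ennreal_leI mult_left_mono mult_mono card_W u) auto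
    finally show ?thesis by (simp add: mult.assoc)
  qed
  have "(\<integral>\<^sup>+ \<omega>. S \<omega> \<partial>M) = (\<Sum>m. \<Sum>l. \<integral>\<^sup>+ \<omega>. (\<Sum>i\<in>W m. \<Sum>j\<in>W l. T m l i j \<omega>) \<partial>M)"
    unfolding S_def by (simp add: nn_integral_suminf)
  also have "\<dots> \<le> (\<Sum>m. \<Sum>l. ennreal (\<kappa> * u m * u l))"
    by (intro suminf_le level summableI)
  also have "\<dots> = (\<Sum>m. ennreal (\<kappa> * u m * suminf u))"
  proof (intro arg_cong[where f = suminf] ext)
    show "(\<Sum>l. ennreal (\<kappa> * u m * u l)) = ennreal (\<kappa> * u m * suminf u)" for m
      using \<kappa> u by (subst suminf_ennreal2) (auto intro: summable_mult simp: suminf_mult)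
  qed
  also have "\<dots> = ennreal (\<Sum>m. \<kappa> * u m * suminf u)"
    using \<kappa> u by (intro suminf_ennreal2 summable_mult2 summable_mult mult_nonneg_nonneg suminf_nonneg) auto
  also have "\<dots> < \<infinity>" by simp
  finally have "(\<integral>\<^sup>+ \<omega>. S \<omega> \<partial>M) \<noteq> \<infinity>" by simp
  moreover have "S \<in> borel_measurable M"
    unfolding S_def by measurable
  ultimately have "AE \<omega> in M. S \<omega> \<noteq> \<infinity>"
    by (intro nn_integral_PInf_AE)
  then show ?thesis
  proof eventually_elim
    case (elim \<omega>)
    \<comment> \<open>\<open>enn2real\<close> keeps the value here because \<open>S \<omega>\<close>
      is finite.\<close>
    have "box m l i j \<omega> \<le> enn2real (S \<omega>) powr (1 / \<eta>) * g m l powr \<gamma>" if "i \<in> W m" "j \<in> W l" for m l i j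
    proof -
      have fin: "finite (W k)" for k by (simp add: W_def)
      have "T m l i j \<omega> \<le> (\<Sum>j\<in>W l. T m l i j \<omega>)"
        using that fin by (intro member_le_sum) auto
      also have "\<dots> \<le> (\<Sum>i\<in>W m. \<Sum>j\<in>W l. T m l i j \<omega>)"
        using that fin by (intro member_le_sum[where f = "\<lambda>i. \<Sum>j\<in>W l. T m l i j \<omega>"]) auto
      also have "\<dots> \<le> (\<Sum>l. \<Sum>i\<in>W m. \<Sum>j\<in>W l. T m l i j \<omega>)"
        using sum_le_suminf[OF summableI, of "{l}" "\<lambda>l. \<Sum>i\<in>W m. \<Sum>j\<in>W l. T m l i j \<omega>"] by simp
      also have "\<dots> \<le> S \<omega>"
        unfolding S_def
        using sum_le_suminf[OF summableI, of "{m}" "\<lambda>m. \<Sum>l. \<Sum>i\<in>W m. \<Sum>j\<in>W l. T m l i j \<omega>"] by simp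
      finally have "(box m l i j \<omega> / g m l powr \<gamma>) powr \<eta> \<le> enn2real (S \<omega>)"
        using elim unfolding T_def by (cases "S \<omega>") auto
      then have "((box m l i j \<omega> / g m l powr \<gamma>) powr \<eta>) powr (1 / \<eta>) \<le> enn2real (S \<omega>) powr (1 / \<eta>)"
        using \<eta> by (intro powr_mono2) auto
      moreover have "((box m l i j \<omega> / g m l powr \<gamma>) powr \<eta>) powr (1 / \<eta>) = box m l i j \<omega> / g m l powr \<gamma>"
        using \<eta> by (simp add: powr_powr box_def)
      ultimately show ?thesis
        using g0[of m l] by (simp add: pos_divide_le_eq)
    qed
    then show ?case
      by (intro exI[of _ "enn2real (S \<omega>) powr (1 / \<eta>)"]) (auto simp: box_def g_def W_def abs_le_iff)
  qed
qed

section \<open>Almost sure convergence along dyadic roundings\<close>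

text \<open>The gauge is at most the area, so geometrically decaying areas make the \<eta>-th
  moments summable. Almost surely the \<eta>-th powers are then summable themselves and tend to
  0.\<close>

lemma AE_box_inc_tendsto_0:
  fixes s t p q :: "nat \<Rightarrow> real"
  assumes "\<And>n. \<bar>t n - s n\<bar> \<le> r" "\<And>n. \<bar>q n - p n\<bar> \<le> r"
    and "0 < A" and small: "\<And>n. \<bar>t n - s n\<bar> * \<bar>q n - p n\<bar> \<le> A / 2 ^ n"
  shows "AE \<omega> in M. (\<lambda>n. box_inc (\<lambda>z. X z \<omega>) (s n) (t n) (p n) (q n)) \<longlonglongrightarrow> 0"
proof -
  define b where "b n \<omega> = \<bar>box_inc (\<lambda>z. X z \<omega>) (s n) (t n) (p n) (q n)\<bar>" for n \<omega>
  have [measurable]: "b n \<in> borel_measurable M" for n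
    unfolding b_def by measurable
  have sm: "summable (\<lambda>n. \<kappa> * (A / 2 ^ n) powr (1 + \<beta>))"
    using \<beta> assms(3) by (intro summable_mult summable_dyadic_powr) auto
  have "(\<integral>\<^sup>+ \<omega>. ennreal (b n \<omega> powr \<eta>) \<partial>M) \<le> ennreal (\<kappa> * (A / 2 ^ n) powr (1 + \<beta>))" for n
  proof -
    have "(\<integral>\<^sup>+ \<omega>. ennreal (b n \<omega> powr \<eta>) \<partial>M) \<le> ennreal (\<kappa> * gauge2 \<alpha> \<bar>t n - s n\<bar> \<bar>q n - p n\<bar> powr (1 + \<beta>))"
      unfolding b_def by (intro moment assms)
    also have "\<dots> \<le> ennreal (\<kappa> * (A / 2 ^ n) powr (1 + \<beta>))"
      using \<kappa> \<beta> \<alpha>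
      by (intro ennreal_leI mult_left_mono powr_mono2 gauge2_nonneg order_trans[OF gauge2_le_mult small]) auto
    finally show ?thesis .
  qed
  then have "(\<integral>\<^sup>+ \<omega>. (\<Sum>n. ennreal (b n \<omega> powr \<eta>)) \<partial>M) \<le> (\<Sum>n. ennreal (\<kappa> * (A / 2 ^ n) powr (1 + \<beta>)))"
    by (subst nn_integral_suminf) (auto intro!: suminf_le)
  also have "\<dots> = ennreal (\<Sum>n. \<kappa> * (A / 2 ^ n) powr (1 + \<beta>))"
    using \<kappa> sm by (intro suminf_ennreal2) auto
  also have "\<dots> < \<infinity>" by simp
  finally have "AE \<omega> in M. (\<Sum>n. ennreal (b n \<omega> powr \<eta>)) \<noteq> \<infinity>"
    by (intro nn_integral_PInf_AE) auto
  then show ?thesis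
  proof eventually_elim
    case (elim \<omega>)
    then have "summable (\<lambda>n. b n \<omega> powr \<eta>)"
      by (intro summable_suminf_not_top) auto
    then have "(\<lambda>n. (b n \<omega> powr \<eta>) powr (1 / \<eta>)) \<longlonglongrightarrow> 0"
      using \<eta> by (intro tendsto_zero_powrI[OF summable_LIMSEQ_zero tendsto_const]) auto
    moreover have "(b n \<omega> powr \<eta>) powr (1 / \<eta>) = b n \<omega>" for n
      using \<eta> by (simp add: powr_powr b_def)
    ultimately show ?case
      unfolding b_def by (simp add: tendsto_rabs_zero_iff)
  qed
qed

end

text \<open>Moments are controlled only for sides up to \<open>r\<close>, while the strips along a
  box may be longer. Cutting \<open>[a, b]\<close> into finitely many short pieces and telescoping
  removes the restriction.\<close>

lemma AE_tendsto_0_subdivide: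
  fixes g :: "nat \<Rightarrow> real \<Rightarrow> 'a \<Rightarrow> real"
  assumes "0 < r" and short: "\<And>a b. \<bar>b - a\<bar> \<le> r \<Longrightarrow> AE \<omega> in M. (\<lambda>n. g n b \<omega> - g n a \<omega>) \<longlonglongrightarrow> 0"
  shows "AE \<omega> in M. (\<lambda>n. g n b \<omega> - g n a \<omega>) \<longlonglongrightarrow> 0"
proof -
  \<comment> \<open>The strict inequality makes \<open>L\<close> positive even for
    \<open>a = b\<close>.\<close>
  obtain L :: nat where L: "\<bar>b - a\<bar> / r < real L"
    using reals_Archimedean2 by blast
  then have L0: "0 < real L" using assms(1) by (meson abs_ge_zero divide_nonneg_pos order_le_less_trans)
  define p where "p i = a + real i * (b - a) / real L" for i
  have "p (Suc i) - p i = (b - a) / real L" for i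
    using L0 by (simp add: p_def field_simps)
  moreover have "\<bar>b - a\<bar> / real L \<le> r"
    using L L0 assms(1) by (simp add: field_simps)
  ultimately have "AE \<omega> in M. (\<lambda>n. g n (p (Suc i)) \<omega> - g n (p i) \<omega>) \<longlonglongrightarrow> 0" for i
    by (intro short) simp
  then have "AE \<omega> in M. \<forall>i. (\<lambda>n. g n (p (Suc i)) \<omega> - g n (p i) \<omega>) \<longlonglongrightarrow> 0"
    by (simp add: AE_all_countable)
  then show ?thesis
  proof eventually_elim
    case (elim \<omega>)
    have "(\<lambda>n. \<Sum>i<L. g n (p (Suc i)) \<omega> - g n (p i) \<omega>) \<longlonglongrightarrow> (\<Sum>i<L. 0)"
      using elim by (intro tendsto_sum) auto
    moreover have "p 0 = a" "p L = b"
      using L0 by (auto simp: p_def)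
    ultimately show ?case
      by (simp add: sum_lessThan_telescope[of "\<lambda>i. g _ (p i) \<omega>"])
  qed
qed

context increment_moments
begin

text \<open>The box and its rounding differ by two thin strips that overlap in a small corner box.
  Almost surely all three increments vanish in the limit, which later identifies the limit field
  with the increments of \<open>X\<close>.\<close>

lemma AE_dyadic_box_tendsto:
  "AE \<omega> in M. (\<lambda>n. box_inc (\<lambda>p. X p \<omega>) 0 (dyadic_round r n x) 0 (dyadic_round r n y))
    \<longlonglongrightarrow> box_inc (\<lambda>p. X p \<omega>) 0 x 0 y"
proof -
  let ?D = "dyadic_round r"
  let ?B = "\<lambda>\<omega>. box_inc (\<lambda>p. X p \<omega>)"
  have close: "\<bar>z - ?D n z\<bar> \<le> r / 2 ^ n" for z :: real and n
    using dyadic_floor_bounds[OF r, where n = n and x = z] by simp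
  have close_r: "\<bar>z - ?D n z\<bar> \<le> r" for z :: real and n
    by (rule order_trans[OF close]) (use r in \<open>simp add: divide_le_eq\<close>)
  have one: "\<bar>z - ?D n z\<bar> * h \<le> r * r / 2 ^ n" "h * \<bar>z - ?D n z\<bar> \<le> r * r / 2 ^ n" if "0 \<le> h" "h \<le> r" for z h :: real and n
    using mult_mono[OF close[of z n] that(2)] that r by (simp_all add: mult.commute[of h])
  have "AE \<omega> in M. (\<lambda>n. (X (x, y) \<omega> - X (?D n x, y) \<omega>) - (X (x, 0) \<omega> - X (?D n x, 0) \<omega>)) \<longlonglongrightarrow> 0"
  proof (rule AE_tendsto_0_subdivide[OF r, where g = "\<lambda>n b \<omega>. X (x, b) \<omega> - X (?D n x, b) \<omega>"])
    fix a b :: real assume "\<bar>b - a\<bar> \<le> r"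
    then show "AE \<omega> in M. (\<lambda>n. (X (x, b) \<omega> - X (?D n x, b) \<omega>) - (X (x, a) \<omega> - X (?D n x, a) \<omega>)) \<longlonglongrightarrow> 0"
      \<comment> \<open>Both sides run backwards here, so the two sign changes cancel.\<close>
      using AE_box_inc_tendsto_0[of "\<lambda>_. x" "\<lambda>n. ?D n x" "\<lambda>_. b" "\<lambda>_. a" "r * r"] close_r one r
      by (simp add: box_inc_def algebra_simps)
  qed
  moreover have "AE \<omega> in M. (\<lambda>n. (X (x, y) \<omega> - X (x, ?D n y) \<omega>) - (X (0, y) \<omega> - X (0, ?D n y) \<omega>)) \<longlonglongrightarrow> 0"
  proof (rule AE_tendsto_0_subdivide[OF r, where g = "\<lambda>n b \<omega>. X (b, y) \<omega> - X (b, ?D n y) \<omega>"])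
    fix a b :: real assume "\<bar>b - a\<bar> \<le> r"
    then show "AE \<omega> in M. (\<lambda>n. (X (b, y) \<omega> - X (b, ?D n y) \<omega>) - (X (a, y) \<omega> - X (a, ?D n y) \<omega>)) \<longlonglongrightarrow> 0"
      using AE_box_inc_tendsto_0[of "\<lambda>_. b" "\<lambda>_. a" "\<lambda>_. y" "\<lambda>n. ?D n y" "r * r"] close_r one r
      by (simp add: box_inc_def algebra_simps)
  qed
  moreover have "AE \<omega> in M. (\<lambda>n. ?B \<omega> (?D n x) x (?D n y) y) \<longlonglongrightarrow> 0"
    using r by (intro AE_box_inc_tendsto_0[where A = "r * r"] close_r one) auto
  ultimately show ?thesis
  proof eventually_elim
    case (elim \<omega>)
    \<comment> \<open>Inclusion-exclusion: both strips are subtracted and the corner counted twice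
      is added back.\<close>
    have "(\<lambda>n. ?B \<omega> 0 x 0 y - (((X (x, y) \<omega> - X (?D n x, y) \<omega>) - (X (x, 0) \<omega> - X (?D n x, 0) \<omega>))
        + ((X (x, y) \<omega> - X (x, ?D n y) \<omega>) - (X (0, y) \<omega> - X (0, ?D n y) \<omega>))
        - ?B \<omega> (?D n x) x (?D n y) y)) \<longlonglongrightarrow> ?B \<omega> 0 x 0 y - (0 + 0 - 0)"
      by (intro tendsto_intros elim)
    then show ?case
      by (simp add: box_inc_def algebra_simps)
  qed
qed

section \<open>Construction of the version\<close>

text \<open>One null set must serve uncountably many \<gamma>. The elementary bounds are needed only
  for rational exponents, because \<open>box_chain\<close> starts from some larger exponent
  anyway.\<close>

lemma AE_dyadic_box_bound:
  "AE \<omega> in M. \<forall>N. \<forall>\<gamma>\<in>{0..<\<beta> / \<eta>}. \<exists>C\<ge>0. dyadic_box_bound (\<lambda>p. X p \<omega>) r \<alpha> N C \<gamma>"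
proof -
  define Q where "Q = \<rat> \<inter> {0..<\<beta> / \<eta>}"
  have "countable Q" unfolding Q_def by (intro countable_Int1 countable_rat)
  then have "AE \<omega> in M. \<forall>N. \<forall>\<gamma>\<in>Q. \<exists>K\<ge>0. \<forall>m l i j. \<bar>i\<bar> \<le> int N * 2 ^ m \<longrightarrow> \<bar>j\<bar> \<le> int N * 2 ^ l \<longrightarrow>
    \<bar>box_inc (\<lambda>p. X p \<omega>) (dyadic r m i) (dyadic r m (i + 1)) (dyadic r l j) (dyadic r l (j + 1))\<bar>
      \<le> K * gauge2 \<alpha> (r / 2 ^ m) (r / 2 ^ l) powr \<gamma>"
    unfolding AE_all_countable by (intro allI AE_ball_countable' AE_elementary_bound) (auto simp: Q_def)
  then show ?thesis
  proof eventually_elim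
    case (elim \<omega>)
    show ?case
    proof (intro allI ballI)
      fix N \<gamma> assume \<gamma>: "\<gamma> \<in> {0..<\<beta> / \<eta>}"
      then obtain \<gamma>' where \<gamma>': "\<gamma>' \<in> \<rat>" "\<gamma> < \<gamma>'" "\<gamma>' < \<beta> / \<eta>"
        using Rats_dense_in_real[of \<gamma> "\<beta> / \<eta>"] by auto
      with \<gamma> have "\<gamma>' \<in> Q" by (auto simp: Q_def)
      then obtain K where "0 \<le> K" "\<And>m l i j. \<bar>i\<bar> \<le> int N * 2 ^ m \<Longrightarrow> \<bar>j\<bar> \<le> int N * 2 ^ l \<Longrightarrow>
        \<bar>box_inc (\<lambda>p. X p \<omega>) (dyadic r m i) (dyadic r m (i + 1)) (dyadic r l j) (dyadic r l (j + 1))\<bar>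
          \<le> K * gauge2 \<alpha> (r / 2 ^ m) (r / 2 ^ l) powr \<gamma>'"
        using elim by blast
      then show "\<exists>C\<ge>0. dyadic_box_bound (\<lambda>p. X p \<omega>) r \<alpha> N C \<gamma>"
        using \<gamma> \<gamma>' by (intro box_chain[OF r \<alpha>]) auto
    qed
  qed
qed

text \<open>Off one null set, the limit of the increments exists and inherits the dyadic bounds. On
  it, the limit is replaced by 0, so that all increments of \<open>Y\<close> vanish; this is how the
  bound reaches every \<omega>.\<close>

lemma ex_version:
  "\<exists>Y. is_version M Y X \<and>
    (\<forall>\<omega>\<in>space M. \<forall>N::nat. \<forall>\<gamma>\<in>{0..<\<beta> / \<eta>}. \<exists>C\<ge>0. \<forall>a b c e.
      \<bar>a\<bar> \<le> real N * r \<longrightarrow> \<bar>b\<bar> \<le> real N * r \<longrightarrow> \<bar>c\<bar> \<le> real N * r \<longrightarrow> \<bar>e\<bar> \<le> real N * r \<longrightarrow>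
      \<bar>box_inc (\<lambda>p. Y p \<omega>) a b c e\<bar> \<le> C * gauge2 \<alpha> \<bar>b - a\<bar> \<bar>e - c\<bar> powr \<gamma>)"
proof -
  let ?D = "dyadic_round r"
  \<comment> \<open>A measurable null set covering the bad event is taken, so that the case
    distinction on \<open>G\<close> keeps \<open>Z\<close> measurable.\<close>
  obtain E where E: "{\<omega> \<in> space M. \<not> (\<forall>N. \<forall>\<gamma>\<in>{0..<\<beta> / \<eta>}. \<exists>C\<ge>0. dyadic_box_bound (\<lambda>p. X p \<omega>) r \<alpha> N C \<gamma>)} \<subseteq> E"
    "emeasure M E = 0" and E_sets [measurable]: "E \<in> sets M"
    using AE_dyadic_box_bound by (rule AE_E)
  define G where "G = space M - E"
  have G_sets [measurable]: "G \<in> sets M" by (simp add: G_def)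
  have AE_G: "AE \<omega> in M. \<omega> \<in> G"
    using E(2) E_sets by (intro AE_I[of _ _ E]) (auto simp: G_def)
  define F where "F p n \<omega> = box_inc (\<lambda>z. X z \<omega>) 0 (?D n (fst p)) 0 (?D n (snd p))" for p n \<omega>
  define Z where "Z p \<omega> = (if \<omega> \<in> G then lim (\<lambda>n. F p n \<omega>) else 0)" for p \<omega>
  \<comment> \<open>The added terms restore the values on the axes. Each depends on at most one
    coordinate, so they cancel in every box increment.\<close>
  define Y where "Y p \<omega> = Z p \<omega> + X (fst p, 0) \<omega> + X (0, snd p) \<omega> - X (0, 0) \<omega>" for p \<omega>
  have [measurable]: "F p n \<in> borel_measurable M" for p n
    unfolding F_def by measurable
  have [measurable]: "Z p \<in> borel_measurable M" for p
    unfolding Z_def by measurable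
  have Y_measurable [measurable]: "Y p \<in> borel_measurable M" for p
    unfolding Y_def by measurable
  have "AE \<omega> in M. Y p \<omega> = X p \<omega>" for p
    using AE_G AE_dyadic_box_tendsto[of "fst p" "snd p"]
  proof eventually_elim
    case (elim \<omega>)
    then have "Z p \<omega> = box_inc (\<lambda>z. X z \<omega>) 0 (fst p) 0 (snd p)"
      by (simp add: Z_def F_def limI)
    then show ?case by (simp add: Y_def box_inc_def)
  qed
  then have "measure M {\<omega> \<in> space M. Y p \<omega> = X p \<omega>} = 1" for p
    by (intro prob_Collect_eq_1[THEN iffD2]) auto
  then have version: "is_version M Y X"
    by (auto simp: is_version_def random_field_def)
  have box_Y: "box_inc (\<lambda>p. Y p \<omega>) a b c e = box_inc (\<lambda>p. Z p \<omega>) a b c e" for \<omega> a b c e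
    by (simp add: box_inc_def Y_def)
  have "\<exists>C\<ge>0. \<forall>a b c e.
      \<bar>a\<bar> \<le> real N * r \<longrightarrow> \<bar>b\<bar> \<le> real N * r \<longrightarrow> \<bar>c\<bar> \<le> real N * r \<longrightarrow> \<bar>e\<bar> \<le> real N * r \<longrightarrow>
      \<bar>box_inc (\<lambda>p. Y p \<omega>) a b c e\<bar> \<le> C * gauge2 \<alpha> \<bar>b - a\<bar> \<bar>e - c\<bar> powr \<gamma>"
    if \<omega>: "\<omega> \<in> space M" and \<gamma>: "\<gamma> \<in> {0..<\<beta> / \<eta>}" for \<omega> N \<gamma>
  proof (cases "\<omega> \<in> G")
    case True
    then have bounds: "\<exists>C\<ge>0. dyadic_box_bound (\<lambda>p. X p \<omega>) r \<alpha> N C \<gamma>" if "\<gamma> \<in> {0..<\<beta> / \<eta>}" for \<gamma>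
      using E(1) that unfolding G_def by blast
    \<comment> \<open>Convergence needs a positive exponent, whereas \<gamma> may be 0; hence a
      second bound with exponent \<open>\<beta> / \<eta> / 2\<close>.\<close>
    have half: "0 < \<beta> / \<eta> / 2" "\<beta> / \<eta> / 2 \<in> {0..<\<beta> / \<eta>}"
      using \<beta> \<eta> by (auto simp: field_simps)
    obtain C' where C': "0 \<le> C'" "dyadic_box_bound (\<lambda>p. X p \<omega>) r \<alpha> N C' (\<beta> / \<eta> / 2)"
      using bounds[OF half(2)] by blast
    obtain C where C: "0 \<le> C" "dyadic_box_bound (\<lambda>p. X p \<omega>) r \<alpha> N C \<gamma>"
      using bounds[OF \<gamma>] by blast
    have "(\<lambda>n. box_inc (\<lambda>p. X p \<omega>) 0 (?D n x) 0 (?D n y)) \<longlonglongrightarrow> Z (x, y) \<omega>"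
      if "\<bar>x\<bar> \<le> real N * r" "\<bar>y\<bar> \<le> real N * r" for x y
      using dyadic_box_convergent[OF r \<alpha> half(1) C' that] True
      by (simp add: Z_def F_def convergent_LIMSEQ_iff)
    then show ?thesis
      unfolding box_Y using C box_inc_limit_bound[OF r C, where Z = "\<lambda>p. Z p \<omega>"] by blast
  next
    case False
    then show ?thesis
      unfolding box_Y by (intro exI[of _ 0]) (simp add: Z_def box_inc_def)
  qed
  with version show ?thesis by blast
qed

end

section \<open>Transfer to steps and bounded intervals\<close>

theorem theorem2p3:
  fixes M :: "'a measure" and X :: "real \<times> real \<Rightarrow> 'a \<Rightarrow> real"
    and \<alpha> \<beta> \<eta> c R :: real
  assumes "prob_space M"
    and "0 \<le> \<alpha>" and "\<alpha> \<le> 1"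
    and "random_field M X"
    and "\<beta> > 0" and "\<eta> > 0" and "c > 0" and "R > 0"
    and "\<And>x1 x2 h1 h2. \<bar>h1\<bar> < R \<Longrightarrow> \<bar>h2\<bar> < R \<Longrightarrow>
      (\<integral>\<^sup>+ \<omega>. ennreal (\<bar>rect_increment X (h1, h2) (x1, x2) \<omega>\<bar> powr \<eta>) \<partial>M)
        \<le> ennreal (c * (max \<bar>h1\<bar> \<bar>h2\<bar> powr (1 - \<alpha>) * min \<bar>h1\<bar> \<bar>h2\<bar> powr (1 + \<alpha>)) powr (1 + \<beta>))"
  shows "\<exists>Y. is_version M Y X \<and>
    (\<forall>\<gamma>\<in>{0..<\<beta> / \<eta>}. \<forall>I J :: real set.
      is_interval I \<longrightarrow> bounded I \<longrightarrow> is_interval J \<longrightarrow> bounded J \<longrightarrow>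
      (\<forall>\<omega>\<in>space M. \<exists>C>0. \<forall>x1\<in>I. \<forall>x2\<in>J. \<forall>h1 h2.
        x1 + h1 \<in> I \<longrightarrow> x2 + h2 \<in> J \<longrightarrow>
        \<bar>rect_increment Y (h1, h2) (x1, x2) \<omega>\<bar>
          \<le> C * (max \<bar>h1\<bar> \<bar>h2\<bar> powr (1 - \<alpha>) * min \<bar>h1\<bar> \<bar>h2\<bar> powr (1 + \<alpha>)) powr \<gamma>))"
proof -
  interpret prob_space M by fact
  \<comment> \<open>Halving \<open>R\<close> turns the strict conditions on the steps into the
    closed range of the locale.\<close>
  interpret increment_moments M X \<alpha> \<beta> \<eta> c "R / 2"
  proof
    fix a b s t :: real
    assume "\<bar>b - a\<bar> \<le> R / 2" "\<bar>t - s\<bar> \<le> R / 2"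
    with \<open>R > 0\<close> have "\<bar>b - a\<bar> < R" "\<bar>t - s\<bar> < R" by linarith+
    from assms(9)[OF this, of a s]
    show "(\<integral>\<^sup>+ \<omega>. ennreal (\<bar>box_inc (\<lambda>p. X p \<omega>) a b s t\<bar> powr \<eta>) \<partial>M)
        \<le> ennreal (c * gauge2 \<alpha> \<bar>b - a\<bar> \<bar>t - s\<bar> powr (1 + \<beta>))"
      by (simp add: rect_increment_eq_box_inc gauge2_def)
  qed (use assms in \<open>auto simp: random_field_def\<close>)
  obtain Y where Y: "is_version M Y X" and bound: "\<And>\<omega> N \<gamma>. \<omega> \<in> space M \<Longrightarrow> \<gamma> \<in> {0..<\<beta> / \<eta>} \<Longrightarrow>
    \<exists>C\<ge>0. \<forall>a b s t. \<bar>a\<bar> \<le> real N * (R / 2) \<longrightarrow> \<bar>b\<bar> \<le> real N * (R / 2) \<longrightarrow>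
      \<bar>s\<bar> \<le> real N * (R / 2) \<longrightarrow> \<bar>t\<bar> \<le> real N * (R / 2) \<longrightarrow>
      \<bar>box_inc (\<lambda>p. Y p \<omega>) a b s t\<bar> \<le> C * gauge2 \<alpha> \<bar>b - a\<bar> \<bar>t - s\<bar> powr \<gamma>"
    using ex_version by blast
  show ?thesis
  proof (intro exI[of _ Y] conjI Y ballI allI impI)
    fix \<gamma> and I J :: "real set" and \<omega>
    assume \<gamma>: "\<gamma> \<in> {0..<\<beta> / \<eta>}" and "bounded I" "bounded J" and \<omega>: "\<omega> \<in> space M"
    then have "bounded (I \<union> J)" by simp
    then obtain B where B: "\<And>x. x \<in> I \<union> J \<Longrightarrow> \<bar>x\<bar> \<le> B"
      unfolding bounded_iff by auto
    \<comment> \<open>A window \<open>[- N * (R / 2), N * (R / 2)]\<close> containing both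
      \<open>I\<close> and \<open>J\<close>.\<close>
    obtain N :: nat where "B / (R / 2) < real N"
      using reals_Archimedean2 by blast
    then have "B \<le> real N * (R / 2)"
      using \<open>R > 0\<close> by (simp add: field_simps)
    with B have win: "\<bar>x\<bar> \<le> real N * (R / 2)" if "x \<in> I \<union> J" for x
      using that order_trans by blast
    obtain C where C: "0 \<le> C" "\<And>a b s t. \<bar>a\<bar> \<le> real N * (R / 2) \<Longrightarrow> \<bar>b\<bar> \<le> real N * (R / 2) \<Longrightarrow>
      \<bar>s\<bar> \<le> real N * (R / 2) \<Longrightarrow> \<bar>t\<bar> \<le> real N * (R / 2) \<Longrightarrow>
      \<bar>box_inc (\<lambda>p. Y p \<omega>) a b s t\<bar> \<le> C * gauge2 \<alpha> \<bar>b - a\<bar> \<bar>t - s\<bar> powr \<gamma>"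
      using bound[OF \<omega> \<gamma>, of N] by blast
    show "\<exists>C>0. \<forall>x1\<in>I. \<forall>x2\<in>J. \<forall>h1 h2. x1 + h1 \<in> I \<longrightarrow> x2 + h2 \<in> J \<longrightarrow>
        \<bar>rect_increment Y (h1, h2) (x1, x2) \<omega>\<bar>
          \<le> C * (max \<bar>h1\<bar> \<bar>h2\<bar> powr (1 - \<alpha>) * min \<bar>h1\<bar> \<bar>h2\<bar> powr (1 + \<alpha>)) powr \<gamma>"
    \<comment> \<open>The constant must be strictly positive, while \<open>C\<close> may be
      0.\<close>
    proof (intro exI[of _ "C + 1"] conjI ballI allI impI)
      fix x1 x2 h1 h2
      assume "x1 \<in> I" "x2 \<in> J" "x1 + h1 \<in> I" "x2 + h2 \<in> J"
      then have "\<bar>rect_increment Y (h1, h2) (x1, x2) \<omega>\<bar> \<le> C * gauge2 \<alpha> \<bar>h1\<bar> \<bar>h2\<bar> powr \<gamma>"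
        using C(2)[of x1 "x1 + h1" x2 "x2 + h2"] win by (simp add: rect_increment_eq_box_inc)
      also have "\<dots> \<le> (C + 1) * gauge2 \<alpha> \<bar>h1\<bar> \<bar>h2\<bar> powr \<gamma>"
        by (intro mult_right_mono) auto
      finally show "\<bar>rect_increment Y (h1, h2) (x1, x2) \<omega>\<bar>
          \<le> (C + 1) * (max \<bar>h1\<bar> \<bar>h2\<bar> powr (1 - \<alpha>) * min \<bar>h1\<bar> \<bar>h2\<bar> powr (1 + \<alpha>)) powr \<gamma>"
        by (simp add: gauge2_def)
    qed (use C(1) in simp)
  qed
qed

end
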